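(* The mapping $\Omega\colon(\mathcal P(\mathbb R_+),\ast)\to(\mathcal P(\mathbb R_+),\vee)$ is a homomorphism; that is, $\Omega(\mu\ast\nu)=\Omega(\mu)\vee\Omega(\nu)$ for all $\mu,\nu\in\mathcal P(\mathbb R_+)$.
   Context: $\mathbb R_+=[0,\infty)$ and $\mathcal P(\mathbb R_+)$ is the set of Borel probability measures on $\mathbb R_+$. $\ast$ is the classical additive convolution. The max-convolution $\vee$ is given by $(\mu\vee\nu)([0,t])=\mu([0,t])\,\nu([0,t])$, $t\ge0$. The cumulant transform of $\mu\in\mathcal P(\mathbb R_+)$ is $C_\mu(t)=\log\int_{\mathbb R_+}e^{tu}\,d\mu(u)$, $t\le0$. For $\mu\in\mathcal P(\mathbb R_+)$, the probability measure $\Omega(\mu)\in\mathcal P(\mathbb R_+)$ is defined by $$\Omega(\mu)([0,t])=\exp\left(\int_0^\infty C_\mu(-x/t)e^{-x}\,dx\right),\quad t\in(0,\infty),\qquad \Omega(\mu)(\{0\})=\mu(\{0\}).$$ *)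

theory Defs
  imports "HOL-Probability.Probability"
begin

text \<open>
  A Borel probability measure on \<open>[0,\<infinity>)\<close> is represented by the Borel probability measure on the
  real line that it induces, i.e. one that gives \<open>[0,\<infinity>)\<close> full mass. The additive convolution is
  then the library operation \<^const>\<open>convolution\<close>, written \<open>\<mu> \<star> \<nu>\<close>.
\<close>

definition Prob_Rplus :: "real measure set" where
  "Prob_Rplus = {\<mu>. real_distribution \<mu> \<and> measure \<mu> {0..} = 1}"

text \<open>
  The next operations are specified by the values of a measure on the intervals \<open>[0,t]\<close>.
  That exactly one measure in \<^const>\<open>Prob_Rplus\<close> has the prescribed values is shown below, in
  \<open>max_convolution_unique_exists\<close> and \<open>Omega_unique_exists\<close>.
\<close>

definition max_convolution :: "real measure \<Rightarrow> real measure \<Rightarrow> real measure"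
    (infix \<open>\<star>\<^sub>\<or>\<close> 50) where
  "\<mu> \<star>\<^sub>\<or> \<nu> = (THE \<rho>. \<rho> \<in> Prob_Rplus \<and>
     (\<forall>t\<ge>0. measure \<rho> {0..t} = measure \<mu> {0..t} * measure \<nu> {0..t}))"

definition cumulant_transform :: "real measure \<Rightarrow> real \<Rightarrow> real" where
  "cumulant_transform \<mu> t = ln (LINT u:{0..}|\<mu>. exp (t * u))"

definition Omega :: "real measure \<Rightarrow> real measure" where
  "Omega \<mu> = (THE \<rho>. \<rho> \<in> Prob_Rplus \<and>
     (\<forall>t>0. measure \<rho> {0..t} =
        exp (LBINT x:{0..}. cumulant_transform \<mu> (- x / t) * exp (- x))) \<and>
     measure \<rho> {0} = measure \<mu> {0})"


subsection \<open>Existence and uniqueness\<close>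

lemma Prob_Rplus_distribution: "\<mu> \<in> Prob_Rplus \<Longrightarrow> real_distribution \<mu>"
  by (simp add: Prob_Rplus_def)

lemma Prob_Rplus_AE:
  assumes "\<mu> \<in> Prob_Rplus"
  shows "AE x in \<mu>. x \<in> {0..}"
proof -
  interpret real_distribution \<mu> using assms by (rule Prob_Rplus_distribution)
  show ?thesis
    using assms prob_eq_1[of "{0..}"] by (auto simp: Prob_Rplus_def)
qed

lemma Prob_Rplus_cdf:
  assumes "\<mu> \<in> Prob_Rplus"
  shows "cdf \<mu> t = measure \<mu> {0..t}"
proof -
  interpret real_distribution \<mu> using assms by (rule Prob_Rplus_distribution)
  show ?thesis
    unfolding cdf_def using Prob_Rplus_AE[OF assms]
    by (intro measure_eq_AE) auto
qed

lemma Prob_Rplus_eqI: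
  assumes "\<mu> \<in> Prob_Rplus" "\<nu> \<in> Prob_Rplus"
    and "\<And>t. 0 \<le> t \<Longrightarrow> measure \<mu> {0..t} = measure \<nu> {0..t}"
  shows "\<mu> = \<nu>"
proof (rule cdf_unique)
  show "cdf \<mu> = cdf \<nu>"
  proof
    fix t show "cdf \<mu> t = cdf \<nu> t"
      using assms by (cases "0 \<le> t") (auto simp: Prob_Rplus_cdf)
  qed
qed (use assms in \<open>auto intro: Prob_Rplus_distribution\<close>)

lemma interval_measure_Prob_Rplus:
  fixes F :: "real \<Rightarrow> real"
  assumes mono: "\<And>x y. x \<le> y \<Longrightarrow> F x \<le> F y"
    and cont: "\<And>a. continuous (at_right a) F"
    and neg: "\<And>t. t < 0 \<Longrightarrow> F t = 0"
    and top: "(F \<longlongrightarrow> 1) at_top"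
  shows "interval_measure F \<in> Prob_Rplus"
    and "measure (interval_measure F) {0..t} = F t"
proof -
  have bot: "(F \<longlongrightarrow> 0) at_bot"
    by (rule tendsto_eventually) (use eventually_gt_at_bot[of 0] neg in
        \<open>auto simp: eventually_at_bot_dense\<close>)
  interpret real_distribution "interval_measure F"
    using mono cont bot top by (rule real_distribution_interval_measure)
  have cdf: "cdf (interval_measure F) = F"
    using mono cont bot by (rule cdf_interval_measure)
  have "(F \<longlongrightarrow> 0) (at_left 0)"
    by (rule tendsto_eventually) (auto simp: eventually_at_left_field neg intro: exI[of _ "-1"])
  with cdf_at_left[of 0] have "measure (interval_measure F) {..<0} = 0"
    by (metis cdf tendsto_unique trivial_limit_at_left_real)
  moreover have "{0..} = UNIV - {..<(0::real)}" by auto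
  ultimately have "measure (interval_measure F) {0..} = 1"
    using prob_compl[of "{..<0}"] by simp
  then show P: "interval_measure F \<in> Prob_Rplus"
    by (simp add: Prob_Rplus_def real_distribution_axioms)
  show "measure (interval_measure F) {0..t} = F t"
    using Prob_Rplus_cdf[OF P, of t] cdf by simp
qed

lemma max_convolution_unique_exists:
  assumes "\<mu> \<in> Prob_Rplus" "\<nu> \<in> Prob_Rplus"
  shows "\<exists>!\<rho>. \<rho> \<in> Prob_Rplus \<and>
    (\<forall>t\<ge>0. measure \<rho> {0..t} = measure \<mu> {0..t} * measure \<nu> {0..t})"
proof -
  interpret M: real_distribution \<mu> using assms by (auto intro: Prob_Rplus_distribution)
  interpret N: real_distribution \<nu> using assms by (auto intro: Prob_Rplus_distribution)
  define F where "F t = cdf \<mu> t * cdf \<nu> t" for t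
  have F: "F t = measure \<mu> {0..t} * measure \<nu> {0..t}" for t
    using assms by (simp add: F_def Prob_Rplus_cdf)
  have 1: "F x \<le> F y" if "x \<le> y" for x y
    unfolding F_def using that
    by (intro mult_mono M.cdf_nondecreasing N.cdf_nondecreasing M.cdf_nonneg N.cdf_nonneg)
  have 2: "continuous (at_right a) F" for a
    unfolding F_def[abs_def]
    by (intro continuous_mult M.cdf_is_right_cont N.cdf_is_right_cont)
  have 3: "F t = 0" if "t < 0" for t using that by (simp add: F)
  have 4: "(F \<longlongrightarrow> 1) at_top"
    using tendsto_mult[OF M.cdf_lim_at_top_prob N.cdf_lim_at_top_prob]
    by (simp add: F_def[abs_def])
  show ?thesis
  proof (rule ex1I[of _ "interval_measure F"])
    show "interval_measure F \<in> Prob_Rplus \<and> (\<forall>t\<ge>0. measure (interval_measure F) {0..t} =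
        measure \<mu> {0..t} * measure \<nu> {0..t})"
      using interval_measure_Prob_Rplus[OF 1 2 3 4] F by auto
  next
    fix \<rho> assume "\<rho> \<in> Prob_Rplus \<and> (\<forall>t\<ge>0. measure \<rho> {0..t} =
        measure \<mu> {0..t} * measure \<nu> {0..t})"
    then show "\<rho> = interval_measure F"
      using interval_measure_Prob_Rplus[OF 1 2 3 4] F by (intro Prob_Rplus_eqI) auto
  qed
qed

lemma convolution_Prob_Rplus:
  assumes "\<mu> \<in> Prob_Rplus" "\<nu> \<in> Prob_Rplus"
  shows "(\<mu> \<star> \<nu>) \<in> Prob_Rplus"
proof -
  interpret M: real_distribution \<mu> using assms by (auto intro: Prob_Rplus_distribution)
  interpret N: real_distribution \<nu> using assms by (auto intro: Prob_Rplus_distribution)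
  interpret pair_prob_space \<mu> \<nu> ..
  have "random_variable borel (\<lambda>(x, y). x + y)" by measurable
  then interpret C: real_distribution "\<mu> \<star> \<nu>"
    unfolding convolution_def by (rule real_distribution_distr)
  have "emeasure (\<mu> \<star> \<nu>) {0..} = (\<integral>\<^sup>+x. \<integral>\<^sup>+y. indicator {0..} (x + y) \<partial>\<nu> \<partial>\<mu>)"
    using nn_integral_convolution[OF M.finite_measure_axioms N.finite_measure_axioms,
        of "indicator {0..}"] by simp
  also have "\<dots> = (\<integral>\<^sup>+x. \<integral>\<^sup>+y. 1 \<partial>\<nu> \<partial>\<mu>)"
  proof (rule nn_integral_cong_AE)
    show "AE x in \<mu>. (\<integral>\<^sup>+y. indicator {0..} (x + y) \<partial>\<nu>) = (\<integral>\<^sup>+y. 1 \<partial>\<nu>)"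
      using Prob_Rplus_AE[OF assms(1)]
    proof eventually_elim
      case (elim x)
      show ?case
        by (rule nn_integral_cong_AE, use Prob_Rplus_AE[OF assms(2)] in eventually_elim)
           (use elim in auto)
    qed
  qed
  also have "\<dots> = 1" using M.emeasure_space_1 N.emeasure_space_1 by simp
  finally show ?thesis
    by (simp add: Prob_Rplus_def C.real_distribution_axioms C.emeasure_eq_measure)
qed

context
  fixes \<mu> :: "real measure"
  assumes \<mu>: "\<mu> \<in> Prob_Rplus"
begin

interpretation real_distribution \<mu> using \<mu> by (rule Prob_Rplus_distribution)

lemma laplace_integrable:
  assumes "t \<le> 0"
  shows "set_integrable \<mu> {0..} (\<lambda>u. exp (t * u))"
  unfolding set_integrable_def using assms
  by (intro integrable_const_bound[of _ 1])
     (auto simp: indicator_def mult_nonpos_nonneg intro!: AE_I2)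

lemma laplace_mono:
  assumes "s \<le> t" "t \<le> 0"
  shows "(LINT u:{0..}|\<mu>. exp (s * u)) \<le> (LINT u:{0..}|\<mu>. exp (t * u))"
  using assms by (intro set_integral_mono laplace_integrable) (auto intro: mult_right_mono)

lemma laplace_0: "(LINT u:{0..}|\<mu>. exp (0 * u)) = 1"
  using \<mu> by (simp add: set_lebesgue_integral_def Prob_Rplus_def)

lemma laplace_lower:
  assumes "t \<le> 0" "0 \<le> K"
  shows "measure \<mu> {0..K} * exp (t * K) \<le> (LINT u:{0..}|\<mu>. exp (t * u))"
proof -
  have "measure \<mu> {0..K} * exp (t * K) = (LINT u|\<mu>. indicator {0..K} u * exp (t * K))"
    by simp
  also have "\<dots> \<le> (LINT u|\<mu>. indicator {0..} u *\<^sub>R exp (t * u))"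
  proof (rule integral_mono)
    show "integrable \<mu> (\<lambda>u. indicator {0..} u *\<^sub>R exp (t * u))"
      using laplace_integrable[OF assms(1)] by (simp add: set_integrable_def)
    fix u show "indicator {0..K} u * exp (t * K) \<le> indicator {0..} u *\<^sub>R exp (t * u)"
      using assms by (auto simp: indicator_def intro: mult_left_mono_neg)
  qed (auto intro!: integrable_mult_left integrable_real_indicator simp: emeasure_eq_measure)
  finally show ?thesis by (simp add: set_lebesgue_integral_def)
qed

lemma half_mass: obtains K where "0 \<le> K" "1 / 2 \<le> measure \<mu> {0..K}"
proof -
  have "eventually (\<lambda>x. cdf \<mu> x > 1 / 2) at_top"
    using cdf_lim_at_top_prob by (rule order_tendstoD) simp
  then have "eventually (\<lambda>x. cdf \<mu> x > 1 / 2 \<and> x \<ge> 0) at_top"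
    using eventually_ge_at_top by (rule eventually_conj)
  then obtain K where "cdf \<mu> K > 1 / 2" "K \<ge> 0"
    by (metis (mono_tags, lifting) eventually_at_top_linorder order_refl)
  then show ?thesis using that[of K] Prob_Rplus_cdf[OF \<mu>, of K] by simp
qed

lemma laplace_pos:
  assumes "t \<le> 0"
  shows "0 < (LINT u:{0..}|\<mu>. exp (t * u))"
proof -
  obtain K where K: "0 \<le> K" "1 / 2 \<le> measure \<mu> {0..K}" by (rule half_mass)
  have "0 < 1 / 2 * exp (t * K)" by simp
  also have "\<dots> \<le> measure \<mu> {0..K} * exp (t * K)"
    using K by (intro mult_right_mono) auto
  also have "\<dots> \<le> (LINT u:{0..}|\<mu>. exp (t * u))" using assms K by (intro laplace_lower)
  finally show ?thesis .
qed

lemma cumulant_mono: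
  assumes "s \<le> t" "t \<le> 0"
  shows "cumulant_transform \<mu> s \<le> cumulant_transform \<mu> t"
  unfolding cumulant_transform_def
  using laplace_mono[OF assms] laplace_pos assms by (subst ln_le_cancel_iff) auto

lemma cumulant_0: "cumulant_transform \<mu> 0 = 0"
  unfolding cumulant_transform_def by (simp only: laplace_0 ln_one)

lemma cumulant_nonpos: "t \<le> 0 \<Longrightarrow> cumulant_transform \<mu> t \<le> 0"
  using cumulant_mono[of t 0] cumulant_0 by simp

lemma cumulant_lower:
  obtains K where "0 \<le> K" "\<And>t. t \<le> 0 \<Longrightarrow> t * K - ln 2 \<le> cumulant_transform \<mu> t"
proof -
  obtain K where K: "0 \<le> K" "1 / 2 \<le> measure \<mu> {0..K}" by (rule half_mass)
  have "t * K - ln 2 \<le> cumulant_transform \<mu> t" if "t \<le> 0" for t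
  proof -
    have "t * K - ln 2 = ln (1 / 2 * exp (t * K))" by (simp add: ln_mult ln_div)
    also have "\<dots> \<le> ln (LINT u:{0..}|\<mu>. exp (t * u))"
    proof (rule ln_mono)
      have "1 / 2 * exp (t * K) \<le> measure \<mu> {0..K} * exp (t * K)"
        using K by (intro mult_right_mono) auto
      also have "\<dots> \<le> (LINT u:{0..}|\<mu>. exp (t * u))" using that K by (intro laplace_lower)
      finally show "1 / 2 * exp (t * K) \<le> (LINT u:{0..}|\<mu>. exp (t * u))" .
    qed (use laplace_pos that in auto)
    finally show ?thesis unfolding cumulant_transform_def by simp
  qed
  with K that show ?thesis by blast
qed

lemma laplace_continuous:
  assumes "f \<longlonglongrightarrow> t" "\<And>n. f n \<le> 0"
  shows "(\<lambda>n. LINT u:{0..}|\<mu>. exp (f n * u)) \<longlonglongrightarrow> (LINT u:{0..}|\<mu>. exp (t * u))"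
  unfolding set_lebesgue_integral_def
proof (rule integral_dominated_convergence[where w="\<lambda>_. 1"])
  show "AE x in \<mu>. (\<lambda>i. indicat_real {0..} x *\<^sub>R exp (f i * x)) \<longlonglongrightarrow>
      indicat_real {0..} x *\<^sub>R exp (t * x)"
    by (intro AE_I2 tendsto_intros assms)
  show "AE x in \<mu>. norm (indicat_real {0..} x *\<^sub>R exp (f i * x)) \<le> 1" for i
    using assms(2)[of i] by (auto simp: indicator_def mult_nonpos_nonneg intro!: AE_I2)
qed auto

lemma cumulant_continuous:
  assumes "f \<longlonglongrightarrow> t" "\<And>n. f n \<le> 0"
  shows "(\<lambda>n. cumulant_transform \<mu> (f n)) \<longlonglongrightarrow> cumulant_transform \<mu> t"
proof -
  have "t \<le> 0" using assms by (intro LIMSEQ_le_const2[of f]) auto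
  then show ?thesis
    unfolding cumulant_transform_def
    using laplace_pos[of t] by (intro tendsto_ln laplace_continuous assms) auto
qed

lemma laplace_at_bot:
  assumes "filterlim f at_bot sequentially" "\<And>n. f n \<le> 0"
  shows "(\<lambda>n. LINT u:{0..}|\<mu>. exp (f n * u)) \<longlonglongrightarrow> measure \<mu> {0}"
proof -
  have "(\<lambda>n. LINT u|\<mu>. indicat_real {0..} u *\<^sub>R exp (f n * u)) \<longlonglongrightarrow> (LINT u|\<mu>. indicat_real {0} u)"
  proof (rule integral_dominated_convergence[where w="\<lambda>_. 1"])
    show "AE x in \<mu>. (\<lambda>i. indicat_real {0..} x *\<^sub>R exp (f i * x)) \<longlonglongrightarrow> indicat_real {0} x"
    proof (rule AE_I2)
      fix x :: real
      consider "x < 0" | "x = 0" | "x > 0" by linarith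
      then show "(\<lambda>i. indicat_real {0..} x *\<^sub>R exp (f i * x)) \<longlonglongrightarrow> indicat_real {0} x"
      proof cases
        case 3
        have "filterlim (\<lambda>n. f n * x) at_bot sequentially"
          using filterlim_tendsto_pos_mult_at_bot[OF tendsto_const[of x] 3 assms(1)]
          by (simp add: mult.commute)
        then have "(\<lambda>n. exp (f n * x)) \<longlonglongrightarrow> 0"
          by (rule filterlim_compose[OF exp_at_bot])
        with 3 show ?thesis by simp
      qed auto
    qed
    show "AE x in \<mu>. norm (indicat_real {0..} x *\<^sub>R exp (f i * x)) \<le> 1" for i
      using assms(2)[of i] by (auto simp: indicator_def mult_nonpos_nonneg intro!: AE_I2)
  qed auto
  then show ?thesis by (simp add: set_lebesgue_integral_def)
qed

lemma cumulant_measurable: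
  assumes "t > 0"
  shows "(\<lambda>x. indicator {0..} x *\<^sub>R (cumulant_transform \<mu> (- x / t) * exp (- x)))
    \<in> borel_measurable lborel"
proof -
  define g where "g x = cumulant_transform \<mu> (- (max 0 x) / t)" for x
  have "mono (\<lambda>x. - g x)"
    unfolding g_def using assms
    by (auto intro!: monoI cumulant_mono divide_right_mono simp: max_def divide_nonpos_pos)
  then have "(\<lambda>x. - g x) \<in> borel_measurable borel" by (rule borel_measurable_mono)
  then have [measurable]: "g \<in> borel_measurable borel" by simp
  have "(\<lambda>x. indicator {0..} x *\<^sub>R (cumulant_transform \<mu> (- x / t) * exp (- x))) =
      (\<lambda>x. indicator {0..} x *\<^sub>R (g x * exp (- x)))"
    by (auto simp: g_def indicator_def)
  also have "\<dots> \<in> borel_measurable lborel" by measurable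
  finally show ?thesis .
qed

lemma exp_integrable: "set_integrable lborel {0..} (\<lambda>x::real. exp (- x))"
  and exp_integral: "(LBINT x:{0..}. exp (- x :: real)) = 1"
proof -
  have "has_bochner_integral lborel (\<lambda>x. (\<lambda>x. x ^ 0 * exp (- x)) x * indicator {0 ..} x) (fact 0 :: real)"
    using has_bochner_integral_I0i_power_exp_m' .
  then have "has_bochner_integral lborel (\<lambda>x. indicator {0 ..} x *\<^sub>R exp (- x)) (1 :: real)"
    by (simp add: mult.commute)
  then show "set_integrable lborel {0..} (\<lambda>x::real. exp (- x))"
    "(LBINT x:{0..}. exp (- x :: real)) = 1"
    by (auto simp: set_integrable_def set_lebesgue_integral_def has_bochner_integral_iff)
qed

lemma x_exp_integrable: "set_integrable lborel {0..} (\<lambda>x::real. x * exp (- x))"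
proof -
  have "has_bochner_integral lborel (\<lambda>x. (\<lambda>x. x ^ 1 * exp (- x)) x * indicator {0 ..} x) (fact 1 :: real)"
    using has_bochner_integral_I0i_power_exp_m' .
  then show ?thesis
    by (auto simp: set_integrable_def has_bochner_integral_iff mult.commute)
qed

lemma Omega_integrable:
  assumes "t > 0"
  shows "set_integrable lborel {0..} (\<lambda>x. cumulant_transform \<mu> (- x / t) * exp (- x))"
proof -
  obtain K where K: "0 \<le> K" "\<And>t. t \<le> 0 \<Longrightarrow> t * K - ln 2 \<le> cumulant_transform \<mu> t"
    by (rule cumulant_lower) blast
  have int: "set_integrable lborel {0..} (\<lambda>x. (K / t) * (x * exp (- x)) + ln 2 * exp (- x))"
    by (intro set_integral_add set_integrable_mult_right x_exp_integrable exp_integrable)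
  show ?thesis
    unfolding set_integrable_def
  proof (rule Bochner_Integration.integrable_bound[OF int[unfolded set_integrable_def]])
    show "AE x in lborel. norm (indicat_real {0..} x *\<^sub>R (cumulant_transform \<mu> (- x / t) * exp (- x)))
      \<le> norm (indicat_real {0..} x *\<^sub>R ((K / t) * (x * exp (- x)) + ln 2 * exp (- x)))"
    proof (rule AE_I2)
      fix x :: real
      show "norm (indicat_real {0..} x *\<^sub>R (cumulant_transform \<mu> (- x / t) * exp (- x)))
        \<le> norm (indicat_real {0..} x *\<^sub>R ((K / t) * (x * exp (- x)) + ln 2 * exp (- x)))"
      proof (cases "0 \<le> x")
        case True
        then have le: "- x / t \<le> 0" using assms by (simp add: divide_nonpos_pos)
        have "\<bar>cumulant_transform \<mu> (- x / t)\<bar> \<le> K / t * x + ln 2"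
          using K(2)[OF le] cumulant_nonpos[OF le] by (simp add: mult.commute)
        then have "\<bar>cumulant_transform \<mu> (- x / t)\<bar> * exp (- x) \<le> (K / t * x + ln 2) * exp (- x)"
          by (intro mult_right_mono) auto
        also have "\<dots> \<le> \<bar>(K / t) * (x * exp (- x)) + ln 2 * exp (- x)\<bar>"
          using abs_ge_self[of "(K / t) * (x * exp (- x)) + ln 2 * exp (- x)"]
          by (simp only: distrib_right mult.assoc)
        finally show ?thesis using True by (simp add: abs_mult)
      qed simp
    qed
  qed (rule cumulant_measurable[OF assms])
qed

lemma Omega_tendsto_sequence:
  assumes lim: "AE x in lborel. x \<in> {0..} \<longrightarrow> (\<lambda>n. cumulant_transform \<mu> (- x / f n)) \<longlonglongrightarrow> g x"
    and f: "\<And>n. 0 < f n"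
    and bound: "\<And>n x. 0 \<le> x \<Longrightarrow> - cumulant_transform \<mu> (- x / f n) \<le> h x"
    and h: "set_integrable lborel {0..} (\<lambda>x. h x * exp (- x))"
    and g: "g \<in> borel_measurable borel"
  shows "(\<lambda>n. LBINT x:{0..}. cumulant_transform \<mu> (- x / f n) * exp (- x)) \<longlonglongrightarrow>
    (LBINT x:{0..}. g x * exp (- x))"
  unfolding set_lebesgue_integral_def
proof (rule integral_dominated_convergence[OF _ _ h[unfolded set_integrable_def]])
  show "(\<lambda>x. indicat_real {0..} x *\<^sub>R (g x * exp (- x))) \<in> borel_measurable lborel"
    using g by measurable
  show "(\<lambda>x. indicat_real {0..} x *\<^sub>R (cumulant_transform \<mu> (- x / f i) * exp (- x)))
      \<in> borel_measurable lborel" for i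
    by (rule cumulant_measurable[OF f])
  show "AE x in lborel. (\<lambda>i. indicat_real {0..} x *\<^sub>R (cumulant_transform \<mu> (- x / f i) * exp (- x)))
      \<longlonglongrightarrow> indicat_real {0..} x *\<^sub>R (g x * exp (- x))"
    using lim by eventually_elim (auto simp: indicator_def intro!: tendsto_mult)
  show "AE x in lborel. norm (indicat_real {0..} x *\<^sub>R (cumulant_transform \<mu> (- x / f i) * exp (- x)))
      \<le> indicat_real {0..} x *\<^sub>R (h x * exp (- x))" for i
  proof (rule AE_I2)
    fix x :: real
    show "norm (indicat_real {0..} x *\<^sub>R (cumulant_transform \<mu> (- x / f i) * exp (- x)))
      \<le> indicat_real {0..} x *\<^sub>R (h x * exp (- x))"
    proof (cases "0 \<le> x")
      case True
      then have "- x / f i \<le> 0" using f[of i] by (simp add: divide_nonpos_pos)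
      from bound[OF True, of i] cumulant_nonpos[OF this]
      have "\<bar>cumulant_transform \<mu> (- x / f i)\<bar> \<le> h x" by simp
      then show ?thesis using True by (simp add: abs_mult)
    qed simp
  qed
qed

definition Omega_cdf :: "real \<Rightarrow> real" where
  "Omega_cdf t = (if t < 0 then 0 else if t = 0 then measure \<mu> {0}
     else exp (LBINT x:{0..}. cumulant_transform \<mu> (- x / t) * exp (- x)))"

lemma Omega_cdf_pos:
  "t > 0 \<Longrightarrow> Omega_cdf t = exp (LBINT x:{0..}. cumulant_transform \<mu> (- x / t) * exp (- x))"
  by (simp add: Omega_cdf_def)

lemma Omega_cdf_0: "Omega_cdf 0 = measure \<mu> {0}"
  by (simp add: Omega_cdf_def)

lemma cumulant_ge_atom:
  assumes "t \<le> 0" "measure \<mu> {0} > 0"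
  shows "ln (measure \<mu> {0}) \<le> cumulant_transform \<mu> t"
  using laplace_lower[of t 0] assms laplace_pos[of t]
  unfolding cumulant_transform_def by (subst ln_le_cancel_iff) auto

lemma Omega_cdf_mono:
  assumes "x \<le> y"
  shows "Omega_cdf x \<le> Omega_cdf y"
proof -
  consider "x < 0" | "x = 0" "y = 0" | "x = 0" "y > 0" | "0 < x" using assms by linarith
  then show ?thesis
  proof cases
    case 1
    then show ?thesis by (simp add: Omega_cdf_def)
  next
    case 2
    then show ?thesis by simp
  next
    case 3
    show ?thesis
    proof (cases "measure \<mu> {0} = 0")
      case True
      then show ?thesis using 3 by (simp add: Omega_cdf_def)
    next
      case False
      then have pos: "measure \<mu> {0} > 0" by (simp add: zero_less_measure_iff)
      have "ln (measure \<mu> {0}) = (LBINT x:{0..}. ln (measure \<mu> {0}) * exp (- x))"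
        by (simp add: exp_integral)
      also have "\<dots> \<le> (LBINT x:{0..}. cumulant_transform \<mu> (- x / y) * exp (- x))"
        using 3 pos
        by (intro set_integral_mono Omega_integrable set_integrable_mult_right exp_integrable
            mult_right_mono cumulant_ge_atom) (auto simp: divide_nonpos_pos)
      finally have "exp (ln (measure \<mu> {0})) \<le>
          exp (LBINT x:{0..}. cumulant_transform \<mu> (- x / y) * exp (- x))" by simp
      then show ?thesis using 3 pos by (simp add: Omega_cdf_def)
    qed
  next
    case 4
    have "(LBINT u:{0..}. cumulant_transform \<mu> (- u / x) * exp (- u)) \<le>
        (LBINT u:{0..}. cumulant_transform \<mu> (- u / y) * exp (- u))"
      using 4 assms
      by (intro set_integral_mono Omega_integrable mult_right_mono cumulant_mono)
         (auto simp: divide_nonpos_pos intro: divide_left_mono)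
    then show ?thesis using 4 assms by (simp add: Omega_cdf_def)
  qed
qed

lemma Omega_cdf_right_cont: "continuous (at_right a) Omega_cdf"
  unfolding continuous_within
proof (rule tendsto_at_right_sequentially[where b="a + 1"])
  fix f :: "nat \<Rightarrow> real"
  assume f: "decseq f" "f \<longlonglongrightarrow> a" "\<And>n. a < f n"
  consider "a < 0" | "a = 0" "measure \<mu> {0} > 0" | "a = 0" "measure \<mu> {0} = 0" | "a > 0"
    by (metis less_eq_real_def linorder_neqE_linordered_idom measure_nonneg)
  then show "(\<lambda>n. Omega_cdf (f n)) \<longlonglongrightarrow> Omega_cdf a"
  proof cases
    case 1
    then have "eventually (\<lambda>n. f n < 0) sequentially"
      using f(2) by (auto dest: order_tendstoD)
    then have "eventually (\<lambda>n. Omega_cdf (f n) = Omega_cdf a) sequentially"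
      by eventually_elim (use 1 in \<open>simp add: Omega_cdf_def\<close>)
    then show ?thesis by (rule tendsto_eventually)
  next
    case 4
    then have pos: "0 < f n" for n using f(3)[of n] by simp
    have meas: "(\<lambda>x. cumulant_transform \<mu> (- max 0 x / a)) \<in> borel_measurable borel"
    proof -
      have "mono (\<lambda>x. - cumulant_transform \<mu> (- max 0 x / a))"
        using 4 by (auto intro!: monoI cumulant_mono divide_right_mono simp: max_def divide_nonpos_pos)
      from borel_measurable_mono[OF this] show ?thesis by simp
    qed
    have "(\<lambda>n. LBINT x:{0..}. cumulant_transform \<mu> (- x / f n) * exp (- x)) \<longlonglongrightarrow>
        (LBINT x:{0..}. cumulant_transform \<mu> (- max 0 x / a) * exp (- x))"
    proof (rule Omega_tendsto_sequence[where h="\<lambda>x. - cumulant_transform \<mu> (- x / a)"])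
      show "AE x in lborel. x \<in> {0..} \<longrightarrow> (\<lambda>n. cumulant_transform \<mu> (- x / f n)) \<longlonglongrightarrow>
          cumulant_transform \<mu> (- max 0 x / a)"
      proof (intro AE_I2 impI)
        fix x :: real assume "x \<in> {0..}"
        then have "- max 0 x / a = - x / a" by simp
        moreover have "(\<lambda>n. - x / f n) \<longlonglongrightarrow> - x / a"
          using 4 by (intro tendsto_intros f) auto
        ultimately show "(\<lambda>n. cumulant_transform \<mu> (- x / f n)) \<longlonglongrightarrow>
            cumulant_transform \<mu> (- max 0 x / a)"
          using pos \<open>x \<in> {0..}\<close> by (auto intro!: cumulant_continuous simp: less_imp_le)
      qed
      show "- cumulant_transform \<mu> (- x / f n) \<le> - cumulant_transform \<mu> (- x / a)"
        if "0 \<le> x" for n x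
      proof -
        have "x / f n \<le> x / a"
          using that 4 pos[of n] f(3)[of n] by (intro divide_left_mono) auto
        then show ?thesis
          using that pos[of n] by (auto intro!: cumulant_mono simp: divide_nonpos_pos)
      qed
      show "set_integrable lborel {0..} (\<lambda>x. - cumulant_transform \<mu> (- x / a) * exp (- x))"
        using Omega_integrable[OF 4] by (simp add: set_integrable_def)
    qed (use pos meas in auto)
    also have "(LBINT x:{0..}. cumulant_transform \<mu> (- max 0 x / a) * exp (- x)) =
        (LBINT x:{0..}. cumulant_transform \<mu> (- x / a) * exp (- x))"
      by (intro set_lebesgue_integral_cong) auto
    finally show ?thesis
      unfolding Omega_cdf_pos[OF pos] Omega_cdf_pos[OF 4] by (rule tendsto_exp)
  next
    case 2
    then have pos: "0 < f n" for n using f(3)[of n] by simp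
    have "(\<lambda>n. LBINT x:{0..}. cumulant_transform \<mu> (- x / f n) * exp (- x)) \<longlonglongrightarrow>
        (LBINT x:{0..}. ln (measure \<mu> {0}) * exp (- x))"
    proof (rule Omega_tendsto_sequence[where h="\<lambda>x. - ln (measure \<mu> {0})"])
      have "AE x in lborel. x \<noteq> (0::real)" by (rule AE_lborel_singleton)
      then show "AE x in lborel. x \<in> {0..} \<longrightarrow> (\<lambda>n. cumulant_transform \<mu> (- x / f n)) \<longlonglongrightarrow>
          ln (measure \<mu> {0})"
      proof eventually_elim
        case (elim x)
        show ?case
        proof
          assume "x \<in> {0..}"
          with elim have x: "x > 0" by simp
          have "filterlim f (at_right 0) sequentially"
            using f 2 pos by (auto simp: filterlim_at less_imp_neq[symmetric])
          then have "filterlim (\<lambda>n. inverse (f n)) at_top sequentially"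
            by (rule filterlim_compose[OF filterlim_inverse_at_top_right])
          then have "filterlim (\<lambda>n. x * inverse (f n)) at_top sequentially"
            by (rule filterlim_tendsto_pos_mult_at_top[OF tendsto_const x])
          then have "filterlim (\<lambda>n. - x / f n) at_bot sequentially"
            by (simp add: filterlim_uminus_at_bot divide_inverse)
          then show "(\<lambda>n. cumulant_transform \<mu> (- x / f n)) \<longlonglongrightarrow> ln (measure \<mu> {0})"
            unfolding cumulant_transform_def using 2 pos x
            by (intro tendsto_ln laplace_at_bot) (auto simp: less_imp_le)
        qed
      qed
      show "- cumulant_transform \<mu> (- x / f n) \<le> - ln (measure \<mu> {0})" if "0 \<le> x" for n x
        using that 2 pos[of n] by (auto intro!: cumulant_ge_atom simp: divide_nonpos_pos)
      show "set_integrable lborel {0..} (\<lambda>x. - ln (measure \<mu> {0}) * exp (- x))"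
        by (intro set_integrable_mult_right exp_integrable)
    qed (use pos in auto)
    then have "(\<lambda>n. exp (LBINT x:{0..}. cumulant_transform \<mu> (- x / f n) * exp (- x))) \<longlonglongrightarrow>
        exp (ln (measure \<mu> {0}))"
      by (intro tendsto_exp) (simp add: exp_integral)
    then show ?thesis
      unfolding Omega_cdf_pos[OF pos] using 2 by (simp add: Omega_cdf_0)
  next
    case 3
    then have pos: "0 < f n" for n using f(3)[of n] by simp
    define L where "L n = (LINT u:{0..}|\<mu>. exp (- 1 / f n * u))" for n
    define A where "A = (LBINT x:{1..}. exp (- x :: real))"
    have int1: "set_integrable lborel {1..} (\<lambda>x::real. exp (- x))"
      by (rule set_integrable_subset[OF exp_integrable]) auto
    have "exp (-2 :: real) = (LBINT x:{1..2::real}. exp (-2 :: real))"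
      by (simp add: set_lebesgue_integral_def)
    also have "\<dots> \<le> A"
      unfolding A_def set_lebesgue_integral_def
    proof (rule integral_mono)
      show "integrable lborel (\<lambda>x. indicat_real {1..2::real} x *\<^sub>R exp (-2 :: real))" by simp
      show "integrable lborel (\<lambda>x. indicat_real {1..} x *\<^sub>R exp (- x :: real))"
        using int1 by (simp add: set_integrable_def)
    qed (simp add: indicator_def)
    finally have A: "A > 0" using exp_gt_zero[of "-2::real"] by linarith
    have Lpos: "L n > 0" for n unfolding L_def using pos[of n] by (intro laplace_pos) auto
    have le: "(LBINT x:{0..}. cumulant_transform \<mu> (- x / f n) * exp (- x)) \<le> ln (L n) * A" for n
    proof -
      have "(LBINT x:{0..}. cumulant_transform \<mu> (- x / f n) * exp (- x)) \<le>
          (LBINT x:{1..}. cumulant_transform \<mu> (- 1 / f n) * exp (- x))"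
        unfolding set_lebesgue_integral_def
      proof (rule integral_mono)
        show "integrable lborel (\<lambda>x. indicator {0..} x *\<^sub>R
            (cumulant_transform \<mu> (- x / f n) * exp (- x)))"
          using Omega_integrable[OF pos] by (simp add: set_integrable_def)
        show "integrable lborel (\<lambda>x. indicator {1..} x *\<^sub>R
            (cumulant_transform \<mu> (- 1 / f n) * exp (- x)))"
          using set_integrable_mult_right[OF int1] by (simp add: set_integrable_def)
        fix x :: real
        consider "x < 0" | "0 \<le> x" "x < 1" | "1 \<le> x" by linarith
        then show "indicator {0..} x *\<^sub>R (cumulant_transform \<mu> (- x / f n) * exp (- x)) \<le>
            indicator {1..} x *\<^sub>R (cumulant_transform \<mu> (- 1 / f n) * exp (- x))"
        proof cases
          case 2
          then show ?thesis
            using cumulant_nonpos[of "- x / f n"] pos[of n]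
            by (simp add: mult_nonpos_nonneg divide_nonpos_pos)
        next
          case 3
          have "cumulant_transform \<mu> (- x / f n) \<le> cumulant_transform \<mu> (- 1 / f n)"
            using 3 pos[of n] by (intro cumulant_mono divide_right_mono) auto
          with 3 show ?thesis by simp
        qed simp
      qed
      also have "\<dots> = ln (L n) * A" by (simp add: A_def L_def cumulant_transform_def)
      finally show ?thesis .
    qed
    have "L \<longlonglongrightarrow> measure \<mu> {0}"
      unfolding L_def
    proof (rule laplace_at_bot)
      have "filterlim f (at_right 0) sequentially"
        using f 3 pos by (auto simp: filterlim_at less_imp_neq[symmetric])
      then have "filterlim (\<lambda>n. inverse (f n)) at_top sequentially"
        by (rule filterlim_compose[OF filterlim_inverse_at_top_right])
      then show "filterlim (\<lambda>n. - 1 / f n) at_bot sequentially"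
        by (simp add: filterlim_uminus_at_bot divide_inverse)
    qed (use pos in \<open>auto simp: less_imp_le\<close>)
    with 3 Lpos have "filterlim L (at_right 0) sequentially"
      by (auto simp: filterlim_at less_imp_neq[symmetric])
    then have "filterlim (\<lambda>n. ln (L n)) at_bot sequentially"
      by (rule filterlim_compose[OF ln_at_0])
    then have "filterlim (\<lambda>n. ln (L n) * A) at_bot sequentially"
      using filterlim_tendsto_pos_mult_at_bot[OF tendsto_const A] by (simp add: mult.commute)
    then have "filterlim (\<lambda>n. LBINT x:{0..}. cumulant_transform \<mu> (- x / f n) * exp (- x))
        at_bot sequentially"
      by (rule filterlim_at_bot_mono) (intro always_eventually allI le)
    then have "(\<lambda>n. exp (LBINT x:{0..}. cumulant_transform \<mu> (- x / f n) * exp (- x))) \<longlonglongrightarrow> 0"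
      by (rule filterlim_compose[OF exp_at_bot])
    then show ?thesis
      unfolding Omega_cdf_pos[OF pos] using 3 by (simp add: Omega_cdf_0)
  qed
qed simp

lemma Omega_cdf_at_top: "(Omega_cdf \<longlongrightarrow> 1) at_top"
proof (rule tendsto_at_topI_sequentially_real[of _ 1])
  show "mono Omega_cdf" by (intro monoI Omega_cdf_mono)
  have "(\<lambda>n. LBINT x:{0..}. cumulant_transform \<mu> (- x / real (Suc n)) * exp (- x)) \<longlonglongrightarrow>
      (LBINT x:{0..}. 0 * exp (- x))"
  proof (rule Omega_tendsto_sequence[where h="\<lambda>x. - cumulant_transform \<mu> (- x / 1)"])
    show "AE x in lborel. x \<in> {0..} \<longrightarrow>
        (\<lambda>n. cumulant_transform \<mu> (- x / real (Suc n))) \<longlonglongrightarrow> 0"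
    proof (intro AE_I2 impI)
      fix x :: real assume "x \<in> {0..}"
      have "(\<lambda>n. - x / real (Suc n)) \<longlonglongrightarrow> 0"
        by (rule LIMSEQ_Suc[OF lim_const_over_n])
      with \<open>x \<in> {0..}\<close> have "(\<lambda>n. cumulant_transform \<mu> (- x / real (Suc n))) \<longlonglongrightarrow> cumulant_transform \<mu> 0"
        by (intro cumulant_continuous) (auto simp: divide_nonpos_pos)
      then show "(\<lambda>n. cumulant_transform \<mu> (- x / real (Suc n))) \<longlonglongrightarrow> 0"
        by (simp add: cumulant_0)
    qed
    show "- cumulant_transform \<mu> (- x / real (Suc n)) \<le> - cumulant_transform \<mu> (- x / 1)"
      if "0 \<le> x" for n x
    proof -
      have "x / real (Suc n) \<le> x / 1" using that by (intro divide_left_mono) auto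
      then show ?thesis using that by (auto intro!: cumulant_mono simp: divide_nonpos_pos)
    qed
    show "set_integrable lborel {0..} (\<lambda>x. - cumulant_transform \<mu> (- x / 1) * exp (- x))"
      using Omega_integrable[of 1] by (simp add: set_integrable_def)
  qed auto
  then have "(\<lambda>n. exp (LBINT x:{0..}. cumulant_transform \<mu> (- x / real (Suc n)) * exp (- x))) \<longlonglongrightarrow>
      exp 0"
    by (intro tendsto_exp) (simp add: set_lebesgue_integral_def)
  then have "(\<lambda>n. Omega_cdf (real (Suc n))) \<longlonglongrightarrow> 1"
    by (simp add: Omega_cdf_def not_less)
  then show "(\<lambda>n. Omega_cdf (real n)) \<longlonglongrightarrow> 1"
    by (rule LIMSEQ_imp_Suc)
qed

lemma Omega_unique_exists:
  "\<exists>!\<rho>. \<rho> \<in> Prob_Rplus \<and>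
     (\<forall>t>0. measure \<rho> {0..t} =
        exp (LBINT x:{0..}. cumulant_transform \<mu> (- x / t) * exp (- x))) \<and>
     measure \<rho> {0} = measure \<mu> {0}"
proof -
  have neg: "Omega_cdf t = 0" if "t < 0" for t using that by (simp add: Omega_cdf_def)
  note W = interval_measure_Prob_Rplus[OF Omega_cdf_mono Omega_cdf_right_cont neg Omega_cdf_at_top]
  show ?thesis
  proof (rule ex1I[of _ "interval_measure Omega_cdf"])
    show "interval_measure Omega_cdf \<in> Prob_Rplus \<and>
      (\<forall>t>0. measure (interval_measure Omega_cdf) {0..t} =
        exp (LBINT x:{0..}. cumulant_transform \<mu> (- x / t) * exp (- x))) \<and>
      measure (interval_measure Omega_cdf) {0} = measure \<mu> {0}"
      using W(1) W(2) W(2)[of 0] by (auto simp: Omega_cdf_def)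
  next
    fix \<rho> assume \<rho>: "\<rho> \<in> Prob_Rplus \<and>
     (\<forall>t>0. measure \<rho> {0..t} =
        exp (LBINT x:{0..}. cumulant_transform \<mu> (- x / t) * exp (- x))) \<and>
     measure \<rho> {0} = measure \<mu> {0}"
    have "measure \<rho> {0..t} = measure (interval_measure Omega_cdf) {0..t}" if "0 \<le> t" for t
      using \<rho> that W(2)[of t] by (cases "t = 0") (auto simp: Omega_cdf_def)
    then show "\<rho> = interval_measure Omega_cdf"
      using \<rho> W(1) by (intro Prob_Rplus_eqI) auto
  qed
qed

end

end

theory Submission
  imports Defs
begin

text \<open>
  The Laplace transform turns additive convolution into multiplication, so the cumulant transform
  turns it into addition. The integral in the exponent of \<^const>\<open>Omega\<close> is linear in the cumulant
  transform, and its exponential is therefore multiplicative. The mass at \<open>0\<close> is multiplicative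
  as well, since it is the limit of the Laplace transform at \<open>-\<infinity>\<close>.
\<close>

text \<open>Integrating against the convolution is integrating over the product measure along
  \<open>x + y\<close>; there the integrand factors almost everywhere, and Fubini separates the two
  variables.\<close>

lemma laplace_convolution:
  assumes "\<mu> \<in> Prob_Rplus" "\<nu> \<in> Prob_Rplus" "t \<le> 0"
  shows "(LINT u:{0..}|\<mu> \<star> \<nu>. exp (t * u)) =
    (LINT u:{0..}|\<mu>. exp (t * u)) * (LINT u:{0..}|\<nu>. exp (t * u))"
proof -
  interpret M: real_distribution \<mu> using assms by (auto intro: Prob_Rplus_distribution)
  interpret N: real_distribution \<nu> using assms by (auto intro: Prob_Rplus_distribution)
  interpret P: pair_prob_space \<mu> \<nu> ..
  let ?e = "\<lambda>u::real. indicator {0..} u * exp (t * u)"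
  \<comment> \<open>For \<open>t\<close> \<le> 0 the exponential is at most 1 on the half-line, so
    the product is bounded and hence integrable for the finite product measure.\<close>
  have e_bound: "\<bar>?e x * ?e y\<bar> \<le> 1" for x y
    unfolding abs_mult[of "?e x"] using assms(3)
    by (intro mult_le_one) (auto simp: indicator_def mult_nonpos_nonneg)
  have [measurable]: "?e \<in> borel_measurable borel" by measurable
  have int: "integrable (\<mu> \<Otimes>\<^sub>M \<nu>) (\<lambda>(x, y). ?e x * ?e y)"
  proof (rule P.integrable_const_bound[of _ 1])
    show "AE p in \<mu> \<Otimes>\<^sub>M \<nu>. norm ((\<lambda>(x, y). ?e x * ?e y) p) \<le> 1"
      by (rule AE_I2) (simp only: split_beta real_norm_def e_bound)
  qed measurable
  have "(LINT u:{0..}|\<mu> \<star> \<nu>. exp (t * u)) = (LINT p|(\<mu> \<Otimes>\<^sub>M \<nu>). ?e (case p of (x, y) \<Rightarrow> x + y))"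
    unfolding set_lebesgue_integral_def convolution_def real_scaleR_def
    by (rule integral_distr) measurable
  also have "\<dots> = (LINT p|(\<mu> \<Otimes>\<^sub>M \<nu>). (case p of (x, y) \<Rightarrow> ?e x * ?e y))"
  proof (rule integral_cong_AE)
    \<comment> \<open>The factorization can fail off the quadrant: with \<open>x\<close> = -1 and
      \<open>y\<close> = 2 the sum is nonnegative but \<open>?e x\<close> is 0. Such pairs form a
      null set.\<close>
    have "AE p in \<mu> \<Otimes>\<^sub>M \<nu>. 0 \<le> fst p \<and> 0 \<le> snd p"
    proof (rule P.AE_pair_measure)
      show "AE x in \<mu>. AE y in \<nu>. 0 \<le> fst (x, y) \<and> 0 \<le> snd (x, y)"
        using Prob_Rplus_AE[OF assms(1)] Prob_Rplus_AE[OF assms(2)] by auto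
    qed measurable
    then show "AE p in \<mu> \<Otimes>\<^sub>M \<nu>. ?e (case p of (x, y) \<Rightarrow> x + y) =
        (case p of (x, y) \<Rightarrow> ?e x * ?e y)"
      by eventually_elim (auto simp: exp_add distrib_left)
  qed measurable
  also have "\<dots> = (LINT x|\<mu>. LINT y|\<nu>. ?e x * ?e y)"
    using P.integral_fst'[OF int] by simp
  also have "\<dots> = (LINT x|\<mu>. ?e x) * (LINT y|\<nu>. ?e y)" by simp
  finally show ?thesis by (simp add: set_lebesgue_integral_def)
qed

lemma cumulant_convolution:
  assumes "\<mu> \<in> Prob_Rplus" "\<nu> \<in> Prob_Rplus" "t \<le> 0"
  shows "cumulant_transform (\<mu> \<star> \<nu>) t = cumulant_transform \<mu> t + cumulant_transform \<nu> t"
  unfolding cumulant_transform_def laplace_convolution[OF assms]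
  \<comment> \<open>Both Laplace integrals are positive, so the logarithm of their product
    splits.\<close>
  using laplace_pos[OF assms(1,3)] laplace_pos[OF assms(2,3)] by (simp add: ln_mult)

lemma atom_convolution:
  assumes "\<mu> \<in> Prob_Rplus" "\<nu> \<in> Prob_Rplus"
  shows "measure (\<mu> \<star> \<nu>) {0} = measure \<mu> {0} * measure \<nu> {0}"
proof -
  \<comment> \<open>Any nonpositive sequence tending to minus infinity would serve here.\<close>
  let ?f = "\<lambda>n. - real n"
  have f: "filterlim ?f at_bot sequentially"
    by (simp add: filterlim_uminus_at_bot filterlim_real_sequentially)
  have "(\<lambda>n. LINT u:{0..}|\<mu> \<star> \<nu>. exp (?f n * u)) \<longlonglongrightarrow> measure (\<mu> \<star> \<nu>) {0}"
    by (rule laplace_at_bot[OF convolution_Prob_Rplus[OF assms] f]) simp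
  moreover have "(\<lambda>n. LINT u:{0..}|\<mu> \<star> \<nu>. exp (?f n * u)) \<longlonglongrightarrow> measure \<mu> {0} * measure \<nu> {0}"
    using tendsto_mult[OF laplace_at_bot[OF assms(1) f] laplace_at_bot[OF assms(2) f]]
    by (subst laplace_convolution[OF assms]) auto
  ultimately show ?thesis by (rule LIMSEQ_unique)
qed

text \<open>Unique existence turns the definite description behind \<open>Omega\<close> into usable
  properties.\<close>

lemma
  assumes "\<mu> \<in> Prob_Rplus"
  shows Omega_Prob_Rplus: "Omega \<mu> \<in> Prob_Rplus"
    and measure_Omega: "t > 0 \<Longrightarrow> measure (Omega \<mu>) {0..t} =
      exp (LBINT x:{0..}. cumulant_transform \<mu> (- x / t) * exp (- x))"
    and Omega_atom: "measure (Omega \<mu>) {0} = measure \<mu> {0}"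
  using theI'[OF Omega_unique_exists[OF assms], folded Omega_def] by blast+

lemma measure_Omega_convolution:
  assumes "\<mu> \<in> Prob_Rplus" "\<nu> \<in> Prob_Rplus" "t \<ge> 0"
  shows "measure (Omega (\<mu> \<star> \<nu>)) {0..t} = measure (Omega \<mu>) {0..t} * measure (Omega \<nu>) {0..t}"
proof (cases "t = 0")
  \<comment> \<open>The exponential formula covers only \<open>t\<close> > 0; at 0 the interval is
    the single point, so the claim is about atoms.\<close>
  case True
  with assms show ?thesis
    by (simp add: Omega_atom convolution_Prob_Rplus atom_convolution)
next
  case False
  with assms have t: "t > 0" by simp
  have "(LBINT x:{0..}. cumulant_transform (\<mu> \<star> \<nu>) (- x / t) * exp (- x)) =
      (LBINT x:{0..}. cumulant_transform \<mu> (- x / t) * exp (- x) +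
        cumulant_transform \<nu> (- x / t) * exp (- x))"
    \<comment> \<open>On the domain of integration \<open>- x / t\<close> \<le> 0, so additivity of
      the cumulant applies pointwise.\<close>
    using t assms
    by (intro set_lebesgue_integral_cong)
       (auto simp: cumulant_convolution divide_nonpos_pos distrib_right)
  also have "\<dots> = (LBINT x:{0..}. cumulant_transform \<mu> (- x / t) * exp (- x)) +
      (LBINT x:{0..}. cumulant_transform \<nu> (- x / t) * exp (- x))"
    using Omega_integrable[OF assms(1) t] Omega_integrable[OF assms(2) t]
    by (rule set_integral_add)
  finally show ?thesis
    using t assms by (simp add: measure_Omega convolution_Prob_Rplus exp_add)
qed

theorem theorem3p14:
  shows "Omega \<in> Prob_Rplus \<rightarrow> Prob_Rplus \<and>
    (\<forall>\<mu>\<in>Prob_Rplus. \<forall>\<nu>\<in>Prob_Rplus. Omega (\<mu> \<star> \<nu>) = (Omega \<mu> \<star>\<^sub>\<or> Omega \<nu>))"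
proof (intro conjI ballI)
  show "Omega \<in> Prob_Rplus \<rightarrow> Prob_Rplus"
    by (auto intro: Omega_Prob_Rplus)
next
  fix \<mu> \<nu> assume "\<mu> \<in> Prob_Rplus" "\<nu> \<in> Prob_Rplus"
  then show "Omega (\<mu> \<star> \<nu>) = (Omega \<mu> \<star>\<^sub>\<or> Omega \<nu>)"
    unfolding max_convolution_def
    \<comment> \<open>\<open>Omega (\<mu> \<star> \<nu>)\<close> meets the specification of the
      max-convolution, which has only one solution.\<close>
    by (intro the1_equality[symmetric] max_convolution_unique_exists)
       (auto simp: Omega_Prob_Rplus convolution_Prob_Rplus measure_Omega_convolution)
qed

end
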